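(* Let $n\ge 1$ and let $\mathcal{N}=A^+(B_n)\cup\{0\}$ be the zero-symmetric affine near-semiring over the Brandt semigroup $B_n$. Then $R_\nu(\mathcal{N})=\{0\}$ for $\nu=0,1$, where $R_0(\mathcal{N})$ is the intersection of all maximal modular right ideals of $\mathcal{N}$ and $R_1(\mathcal{N})$ is the intersection of all modular maximal right ideals of $\mathcal{N}$.
   Context: Arguments of maps are written on the left: $xf$ is the value of $f$ at $x$. A near-semiring is a triple $(\mathcal{M},+,\cdot)$ such that $(\mathcal{M},+)$ and $(\mathcal{M},\cdot)$ are semigroups (not assumed commutative) and $a\cdot(b+c)=a\cdot b+a\cdot c$ for all $a,b,c$. It is zero-symmetric if there is $0\in\mathcal{M}$ with $a+0=0+a=a$ and $a\cdot 0=0\cdot a=0$ for all $a$. For a semigroup $(S,+)$, $M(S)$ is the near-semiring of all maps $S\to S$ with $x(f+g)=xf+xg$ and $x(fg)=(xf)g$. An affine map on $S$ is a map $g+h$ with $g$ an endomorphism of $(S,+)$ and $h$ a constant map on $S$. $A^+(S)$ is the subnear-semiring of $M(S)$ generated by all affine maps. The Brandt semigroup is $B_n=([n]\times[n])\cup\{\vartheta\}$, $[n]=\{1,\dots,n\}$, with $(i,j)+(k,l)=(i,l)$ if $j=k$ and $=\vartheta$ if $j\ne k$, and $\alpha+\vartheta=\vartheta+\alpha=\vartheta$ for all $\alpha\in B_n$. $\mathcal{N}=A^+(B_n)\cup\{0\}$, where $0$ is a new element adjoined to $A^+(B_n)$ with $0+f=f+0=f$ and $0f=f0=0$ for all $f\in\mathcal{N}$;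 it is a zero-symmetric near-semiring. An $\mathcal{N}$-semigroup is a semigroup $(S,+)$ with identity $0_S$ and a map $S\times\mathcal{N}\to S$, $(s,a)\mapsto sa$, such that $s(a+b)=sa+sb$, $s(ab)=(sa)b$ and $s0=0_S$ for all $s\in S$, $a,b\in\mathcal{N}$. $\mathcal{N}^+$ denotes $(\mathcal{N},+)$ regarded as an $\mathcal{N}$-semigroup via the multiplication of $\mathcal{N}$. An $\mathcal{N}$-morphism between $\mathcal{N}$-semigroups $S,S'$ is a semigroup homomorphism $\phi:S\to S'$ with $(sa)\phi=(s\phi)a$ for all $s\in S,a\in\mathcal{N}$; its kernel is $\{s\in S: s\phi=0_{S'}\}$. A right ideal of $\mathcal{N}$ is the kernel of an $\mathcal{N}$-morphism from $\mathcal{N}^+$ to some $\mathcal{N}$-semigroup. A homomorphism $\phi$ defined on $(\mathcal{N},+)$ is modular if there is $u\in\mathcal{N}$ with $x\phi=(ux)\phi$ for all $x\in\mathcal{N}$. A right ideal is modular if it is the kernel of some modular $\mathcal{N}$-morphism of $\mathcal{N}^+$. A maximal right ideal is a right ideal $\ne\mathcal{N}$ that is maximal under inclusion among right ideals $\ne\mathcal{N}$. A modular maximal right ideal is a maximal right ideal that is modular. A maximal modular right ideal is a modular right ideal $\neq\mathcal{N}$ that is maximal under inclusion among modular right ideals $\ne\mathcal{N}$. The empty intersection of subsets of $\mathcal{N}$ is $\mathcal{N}$. *)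

theory Defs
  imports "HOL-Algebra.Congruence"
begin

section \<open>Semigroups and near-semirings\<close>

text \<open>Neither operation of a near-semiring is assumed commutative, and only left distributivity
  \<open>x(y + z) = xy + xz\<close> is required. In the source maps are written on the right of their argument,
  so the product \<open>fg\<close> of maps below is \<open>\<lambda>x. g (f x)\<close>.\<close>

record 'a sgroup = "'a partial_object" +
  plus :: "'a \<Rightarrow> 'a \<Rightarrow> 'a" (infixl "\<oplus>\<index>" 65)

record 'a nearsr = "'a sgroup" +
  times :: "'a \<Rightarrow> 'a \<Rightarrow> 'a" (infixl "\<otimes>\<index>" 70)

record 'a znearsr = "'a nearsr" +
  null :: 'a ("\<zero>\<index>")

locale semigrp =
  fixes S :: "('a, 'b) sgroup_scheme" (structure)
  assumes plus_closed: "\<lbrakk>x \<in> carrier S; y \<in> carrier S\<rbrakk> \<Longrightarrow> x \<oplus> y \<in> carrier S"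
    and plus_assoc: "\<lbrakk>x \<in> carrier S; y \<in> carrier S; z \<in> carrier S\<rbrakk>
          \<Longrightarrow> (x \<oplus> y) \<oplus> z = x \<oplus> (y \<oplus> z)"

locale near_semiring = semigrp N
  for N :: "('a, 'b) nearsr_scheme" (structure) +
  assumes times_closed: "\<lbrakk>x \<in> carrier N; y \<in> carrier N\<rbrakk> \<Longrightarrow> x \<otimes> y \<in> carrier N"
    and times_assoc: "\<lbrakk>x \<in> carrier N; y \<in> carrier N; z \<in> carrier N\<rbrakk>
          \<Longrightarrow> (x \<otimes> y) \<otimes> z = x \<otimes> (y \<otimes> z)"
    and distrib: "\<lbrakk>x \<in> carrier N; y \<in> carrier N; z \<in> carrier N\<rbrakk>
          \<Longrightarrow> x \<otimes> (y \<oplus> z) = x \<otimes> y \<oplus> x \<otimes> z"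

locale zero_symmetric_near_semiring = near_semiring N
  for N :: "('a, 'b) znearsr_scheme" (structure) +
  assumes null_closed: "\<zero> \<in> carrier N"
    and plus_null: "x \<in> carrier N \<Longrightarrow> x \<oplus> \<zero> = x"
    and null_plus: "x \<in> carrier N \<Longrightarrow> \<zero> \<oplus> x = x"
    and times_null: "x \<in> carrier N \<Longrightarrow> x \<otimes> \<zero> = \<zero>"
    and null_times: "x \<in> carrier N \<Longrightarrow> \<zero> \<otimes> x = \<zero>"

definition sgroup_hom :: "('a, 'c) sgroup_scheme \<Rightarrow> ('b, 'd) sgroup_scheme \<Rightarrow> ('a \<Rightarrow> 'b) set" where
  "sgroup_hom S T = {h \<in> carrier S \<rightarrow> carrier T.
     \<forall>x \<in> carrier S. \<forall>y \<in> carrier S. h (x \<oplus>\<^bsub>S\<^esub> y) = h x \<oplus>\<^bsub>T\<^esub> h y}"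

text \<open>The near-semiring \<open>M(S)\<close>; a self-map of the carrier is represented by an extensional function,
  so that distinct elements are distinct maps.\<close>

definition map_nearsr :: "('a, 'b) sgroup_scheme \<Rightarrow> ('a \<Rightarrow> 'a) nearsr" where
  "map_nearsr S = \<lparr>carrier = carrier S \<rightarrow>\<^sub>E carrier S,
     plus = (\<lambda>f g. \<lambda>x \<in> carrier S. f x \<oplus>\<^bsub>S\<^esub> g x),
     times = (\<lambda>f g. \<lambda>x \<in> carrier S. g (f x))\<rparr>"

definition affine_maps :: "('a, 'b) sgroup_scheme \<Rightarrow> ('a \<Rightarrow> 'a) set" where
  "affine_maps S = {g \<oplus>\<^bsub>map_nearsr S\<^esub> h | g h.
     g \<in> carrier (map_nearsr S) \<inter> sgroup_hom S S \<and> h \<in> {\<lambda>x \<in> carrier S. c | c. c \<in> carrier S}}"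

inductive_set generated :: "('a, 'b) nearsr_scheme \<Rightarrow> 'a set \<Rightarrow> 'a set"
  for N :: "('a, 'b) nearsr_scheme" and X :: "'a set" where
  incl: "x \<in> X \<Longrightarrow> x \<in> generated N X"
| plus: "\<lbrakk>x \<in> generated N X; y \<in> generated N X\<rbrakk> \<Longrightarrow> x \<oplus>\<^bsub>N\<^esub> y \<in> generated N X"
| times: "\<lbrakk>x \<in> generated N X; y \<in> generated N X\<rbrakk> \<Longrightarrow> x \<otimes>\<^bsub>N\<^esub> y \<in> generated N X"

definition affine_nearsr :: "('a, 'b) sgroup_scheme \<Rightarrow> ('a \<Rightarrow> 'a) nearsr" where
  "affine_nearsr S = (map_nearsr S)\<lparr>carrier := generated (map_nearsr S) (affine_maps S)\<rparr>"

fun lift_plus :: "('a \<Rightarrow> 'a \<Rightarrow> 'a) \<Rightarrow> 'a option \<Rightarrow> 'a option \<Rightarrow> 'a option" where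
  "lift_plus p None y = y"
| "lift_plus p x None = x"
| "lift_plus p (Some x) (Some y) = Some (p x y)"

fun lift_times :: "('a \<Rightarrow> 'a \<Rightarrow> 'a) \<Rightarrow> 'a option \<Rightarrow> 'a option \<Rightarrow> 'a option" where
  "lift_times m (Some x) (Some y) = Some (m x y)"
| "lift_times m _ _ = None"

text \<open>\<open>None\<close> is the adjoined zero.\<close>

definition adjoin_zero :: "('a, 'b) nearsr_scheme \<Rightarrow> 'a option znearsr" where
  "adjoin_zero N = \<lparr>carrier = insert None (Some ` carrier N),
     plus = lift_plus (plus N), times = lift_times (times N), null = None\<rparr>"

section \<open>The Brandt semigroup\<close>

datatype brandt = Elem nat nat | Theta ("\<vartheta>")

fun brandt_plus :: "brandt \<Rightarrow> brandt \<Rightarrow> brandt" where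
  "brandt_plus (Elem i j) (Elem k l) = (if j = k then Elem i l else \<vartheta>)"
| "brandt_plus _ _ = \<vartheta>"

definition Brandt :: "nat \<Rightarrow> brandt sgroup" where
  "Brandt n = \<lparr>carrier = insert \<vartheta> {Elem i j | i j. i \<in> {1..n} \<and> j \<in> {1..n}}, plus = brandt_plus\<rparr>"

definition brandt_nearsr :: "nat \<Rightarrow> (brandt \<Rightarrow> brandt) option znearsr" where
  "brandt_nearsr n = adjoin_zero (affine_nearsr (Brandt n))"

section \<open>\<open>N\<close>-semigroups, right ideals and radicals\<close>

record ('s, 'a) nsemigroup = "'s sgroup" +
  ident :: 's
  act :: "'s \<Rightarrow> 'a \<Rightarrow> 's" (infixl "\<odot>\<index>" 70)

locale N_semigroup = semigrp S
  for N :: "('a, 'b) znearsr_scheme" and S :: "('s, 'a, 'c) nsemigroup_scheme" (structure) +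
  assumes ident_closed: "ident S \<in> carrier S"
    and plus_ident: "s \<in> carrier S \<Longrightarrow> s \<oplus> ident S = s"
    and ident_plus: "s \<in> carrier S \<Longrightarrow> ident S \<oplus> s = s"
    and act_closed: "\<lbrakk>s \<in> carrier S; a \<in> carrier N\<rbrakk> \<Longrightarrow> s \<odot> a \<in> carrier S"
    and act_plus: "\<lbrakk>s \<in> carrier S; a \<in> carrier N; b \<in> carrier N\<rbrakk>
          \<Longrightarrow> s \<odot> (a \<oplus>\<^bsub>N\<^esub> b) = s \<odot> a \<oplus> s \<odot> b"
    and act_times: "\<lbrakk>s \<in> carrier S; a \<in> carrier N; b \<in> carrier N\<rbrakk>
          \<Longrightarrow> s \<odot> (a \<otimes>\<^bsub>N\<^esub> b) = (s \<odot> a) \<odot> b"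
    and act_null: "s \<in> carrier S \<Longrightarrow> s \<odot> \<zero>\<^bsub>N\<^esub> = ident S"

definition regular :: "('a, 'b) znearsr_scheme \<Rightarrow> ('a, 'a) nsemigroup" where
  "regular N = \<lparr>carrier = carrier N, plus = plus N, ident = \<zero>\<^bsub>N\<^esub>, act = times N\<rparr>"

definition N_hom :: "('a, 'b) znearsr_scheme \<Rightarrow> ('s, 'a, 'c) nsemigroup_scheme \<Rightarrow>
    ('t, 'a, 'd) nsemigroup_scheme \<Rightarrow> ('s \<Rightarrow> 't) set" where
  "N_hom N S T = {\<phi> \<in> sgroup_hom S T.
     \<forall>s \<in> carrier S. \<forall>a \<in> carrier N. \<phi> (s \<odot>\<^bsub>S\<^esub> a) = \<phi> s \<odot>\<^bsub>T\<^esub> a}"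

definition N_kernel :: "('s, 'a, 'c) nsemigroup_scheme \<Rightarrow> ('t, 'a, 'd) nsemigroup_scheme \<Rightarrow>
    ('s \<Rightarrow> 't) \<Rightarrow> 's set" where
  "N_kernel S T \<phi> = {s \<in> carrier S. \<phi> s = ident T}"

definition modular_map :: "('a, 'b) znearsr_scheme \<Rightarrow> ('a \<Rightarrow> 't) \<Rightarrow> bool" where
  "modular_map N \<phi> \<longleftrightarrow> (\<exists>u \<in> carrier N. \<forall>x \<in> carrier N. \<phi> x = \<phi> (u \<otimes>\<^bsub>N\<^esub> x))"

text \<open>The existential quantifier over all \<open>N\<close>-semigroups must range over a fixed type in HOL. The
  element type of \<open>N\<close> itself is large enough: only the image of \<open>\<phi>\<close> matters, and it has at most as
  many elements as \<open>N\<close>. See \<open>right_ideal_N_kernel\<close> and \<open>modular_right_ideal_N_kernel\<close> below, where the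
  target has an arbitrary type.\<close>

definition right_ideal :: "('a, 'b) znearsr_scheme \<Rightarrow> 'a set \<Rightarrow> bool" where
  "right_ideal N I \<longleftrightarrow> (\<exists>(S :: ('a, 'a) nsemigroup) \<phi>. N_semigroup N S \<and>
     \<phi> \<in> N_hom N (regular N) S \<and> I = N_kernel (regular N) S \<phi>)"

definition modular_right_ideal :: "('a, 'b) znearsr_scheme \<Rightarrow> 'a set \<Rightarrow> bool" where
  "modular_right_ideal N I \<longleftrightarrow> (\<exists>(S :: ('a, 'a) nsemigroup) \<phi>. N_semigroup N S \<and>
     \<phi> \<in> N_hom N (regular N) S \<and> modular_map N \<phi> \<and> I = N_kernel (regular N) S \<phi>)"

definition maximal_right_ideal :: "('a, 'b) znearsr_scheme \<Rightarrow> 'a set \<Rightarrow> bool" where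
  "maximal_right_ideal N I \<longleftrightarrow> right_ideal N I \<and> I \<noteq> carrier N \<and>
     (\<forall>J. right_ideal N J \<and> J \<noteq> carrier N \<and> I \<subseteq> J \<longrightarrow> J = I)"

definition modular_maximal_right_ideal :: "('a, 'b) znearsr_scheme \<Rightarrow> 'a set \<Rightarrow> bool" where
  "modular_maximal_right_ideal N I \<longleftrightarrow> maximal_right_ideal N I \<and> modular_right_ideal N I"

definition maximal_modular_right_ideal :: "('a, 'b) znearsr_scheme \<Rightarrow> 'a set \<Rightarrow> bool" where
  "maximal_modular_right_ideal N I \<longleftrightarrow> modular_right_ideal N I \<and> I \<noteq> carrier N \<and>
     (\<forall>J. modular_right_ideal N J \<and> J \<noteq> carrier N \<and> I \<subseteq> J \<longrightarrow> J = I)"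

definition R0 :: "('a, 'b) znearsr_scheme \<Rightarrow> 'a set" where
  "R0 N = carrier N \<inter> \<Inter> {I. maximal_modular_right_ideal N I}"

definition R1 :: "('a, 'b) znearsr_scheme \<Rightarrow> 'a set" where
  "R1 N = carrier N \<inter> \<Inter> {I. modular_maximal_right_ideal N I}"

section \<open>Consistency of the definitions\<close>

lemma near_semiring_map_nearsr:
  assumes "semigrp S"
  shows "near_semiring (map_nearsr S)"
proof -
  interpret semigrp S by fact
  show ?thesis
    by unfold_locales
      (auto simp: map_nearsr_def PiE_iff plus_closed plus_assoc intro!: restrict_ext)
qed

lemma generated_affine_subset:
  assumes "semigrp S"
  shows "generated (map_nearsr S) (affine_maps S) \<subseteq> carrier (map_nearsr S)"
proof
  interpret near_semiring "map_nearsr S" using assms by (rule near_semiring_map_nearsr)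
  fix f assume "f \<in> generated (map_nearsr S) (affine_maps S)"
  then show "f \<in> carrier (map_nearsr S)"
  proof induction
    case (incl f)
    then obtain g c where "f = g \<oplus>\<^bsub>map_nearsr S\<^esub> (\<lambda>x \<in> carrier S. c)"
      "g \<in> carrier (map_nearsr S)" "c \<in> carrier S"
      by (auto simp: affine_maps_def)
    moreover from this have "(\<lambda>x \<in> carrier S. c) \<in> carrier (map_nearsr S)"
      by (auto simp: map_nearsr_def)
    ultimately show ?case by (simp add: plus_closed)
  qed (auto intro: plus_closed times_closed)
qed

lemma near_semiring_affine_nearsr:
  assumes "semigrp S"
  shows "near_semiring (affine_nearsr S)"
proof -
  interpret near_semiring "map_nearsr S" using assms by (rule near_semiring_map_nearsr)
  have sub: "f \<in> carrier (map_nearsr S)"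
    if "f \<in> generated (map_nearsr S) (affine_maps S)" for f
    using generated_affine_subset[OF assms] that by blast
  show ?thesis
    by unfold_locales
      (simp_all add: affine_nearsr_def generated.plus generated.times sub
        plus_assoc times_assoc distrib)
qed

lemma zero_symmetric_adjoin_zero:
  assumes "near_semiring N"
  shows "zero_symmetric_near_semiring (adjoin_zero N)"
proof -
  interpret near_semiring N by fact
  show ?thesis
    by unfold_locales
      (auto simp: adjoin_zero_def plus_closed plus_assoc times_closed times_assoc distrib)
qed

lemma semigrp_Brandt: "semigrp (Brandt n)"
proof
  fix x y z
  show "x \<oplus>\<^bsub>Brandt n\<^esub> y \<oplus>\<^bsub>Brandt n\<^esub> z = x \<oplus>\<^bsub>Brandt n\<^esub> (y \<oplus>\<^bsub>Brandt n\<^esub> z)"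
    by (cases x; cases y; cases z) (simp_all add: Brandt_def)
  assume "x \<in> carrier (Brandt n)" "y \<in> carrier (Brandt n)"
  then show "x \<oplus>\<^bsub>Brandt n\<^esub> y \<in> carrier (Brandt n)"
    by (cases x; cases y) (simp_all add: Brandt_def)
qed

lemma zero_symmetric_brandt_nearsr: "zero_symmetric_near_semiring (brandt_nearsr n)"
  unfolding brandt_nearsr_def
  by (intro zero_symmetric_adjoin_zero near_semiring_affine_nearsr semigrp_Brandt)

lemma N_semigroup_regular:
  assumes "zero_symmetric_near_semiring N"
  shows "N_semigroup N (regular N)"
proof -
  interpret zero_symmetric_near_semiring N by fact
  show ?thesis
    by unfold_locales (simp_all add: regular_def plus_closed plus_assoc times_closed times_assoc
        distrib null_closed plus_null null_plus times_null)
qed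

lemma N_hom_image_copy:
  fixes N :: "('a, 'b) znearsr_scheme" and S :: "('s, 'a, 'c) nsemigroup_scheme"
  assumes "zero_symmetric_near_semiring N" and "N_semigroup N S"
    and "\<phi> \<in> N_hom N (regular N) S"
  obtains T :: "('a, 'a) nsemigroup" and \<psi> where "N_semigroup N T" "\<psi> \<in> N_hom N (regular N) T"
    "N_kernel (regular N) T \<psi> = N_kernel (regular N) S \<phi>"
    "modular_map N \<phi> \<Longrightarrow> modular_map N \<psi>"
proof -
  interpret N: zero_symmetric_near_semiring N by fact
  interpret S: N_semigroup N S by fact
  have \<phi>: "\<phi> x \<in> carrier S" if "x \<in> carrier N" for x
    using assms(3) that by (auto simp: N_hom_def sgroup_hom_def regular_def)
  have \<phi>_ops: "\<phi> (x \<oplus>\<^bsub>N\<^esub> y) = \<phi> x \<oplus>\<^bsub>S\<^esub> \<phi> y" "\<phi> (x \<otimes>\<^bsub>N\<^esub> y) = \<phi> x \<odot>\<^bsub>S\<^esub> y"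
    if "x \<in> carrier N" "y \<in> carrier N" for x y
    using assms(3) that by (auto simp: N_hom_def sgroup_hom_def regular_def)
  have \<phi>0: "\<phi> \<zero>\<^bsub>N\<^esub> = ident S"
    using \<phi>_ops(2)[OF N.null_closed N.null_closed] S.act_null[OF \<phi>[OF N.null_closed]]
      N.times_null[OF N.null_closed] by simp
  define e where "e = inv_into (carrier N) \<phi> \<circ> \<phi>"
  define T :: "('a, 'a) nsemigroup" where
    "T = \<lparr>carrier = e ` carrier N, plus = (\<lambda>x y. e (x \<oplus>\<^bsub>N\<^esub> y)),
      ident = e \<zero>\<^bsub>N\<^esub>, act = (\<lambda>x a. e (x \<otimes>\<^bsub>N\<^esub> a))\<rparr>"
  have e: "e x \<in> carrier N" "\<phi> (e x) = \<phi> x" if "x \<in> carrier N" for x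
    using inv_into_into[of "\<phi> x" \<phi> "carrier N"] f_inv_into_f[of "\<phi> x" \<phi> "carrier N"] that
    by (simp_all add: e_def)
  have e_cong: "e x = e y" if "\<phi> x = \<phi> y" for x y
    using that by (simp add: e_def)
  have e_simps: "e (e x \<oplus>\<^bsub>N\<^esub> y) = e (x \<oplus>\<^bsub>N\<^esub> y)" "e (x \<oplus>\<^bsub>N\<^esub> e y) = e (x \<oplus>\<^bsub>N\<^esub> y)"
    "e (e x \<otimes>\<^bsub>N\<^esub> y) = e (x \<otimes>\<^bsub>N\<^esub> y)" if "x \<in> carrier N" "y \<in> carrier N" for x y
    by (rule e_cong, simp add: \<phi>_ops e that)+
  have e_idem: "e (e x) = e x" if "x \<in> carrier N" for x
    by (rule e_cong) (simp add: e that)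
  have T: "N_semigroup N T"
    by unfold_locales
      (auto simp: T_def e e_idem e_simps N.plus_closed N.times_closed N.null_closed N.plus_assoc
        N.times_assoc N.plus_null N.null_plus N.times_null simp flip: N.distrib)
  have hom: "e \<in> N_hom N (regular N) T"
    by (auto simp: N_hom_def sgroup_hom_def regular_def T_def e e_simps)
  have "e x = e \<zero>\<^bsub>N\<^esub> \<longleftrightarrow> \<phi> x = ident S" if "x \<in> carrier N" for x
    using e(2)[OF that] e(2)[OF N.null_closed] e_cong[of x "\<zero>\<^bsub>N\<^esub>"] \<phi>0 by auto
  then have ker: "N_kernel (regular N) T e = N_kernel (regular N) S \<phi>"
    by (auto simp: N_kernel_def regular_def T_def)
  have "modular_map N e" if mod: "modular_map N \<phi>"
  proof -
    obtain u where u: "u \<in> carrier N" "\<And>x. x \<in> carrier N \<Longrightarrow> \<phi> x = \<phi> (u \<otimes>\<^bsub>N\<^esub> x)"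
      using mod unfolding modular_map_def by blast
    have "e x = e (u \<otimes>\<^bsub>N\<^esub> x)" if "x \<in> carrier N" for x
      by (rule e_cong, rule u(2), fact that)
    with u(1) show ?thesis unfolding modular_map_def by blast
  qed
  with T hom ker show thesis by (rule that)
qed

lemma right_ideal_N_kernel:
  fixes S :: "('s, 'a, 'c) nsemigroup_scheme"
  assumes "zero_symmetric_near_semiring N" "N_semigroup N S" "\<phi> \<in> N_hom N (regular N) S"
  shows "right_ideal N (N_kernel (regular N) S \<phi>)"
  by (rule N_hom_image_copy[OF assms]) (auto simp: right_ideal_def)

lemma modular_right_ideal_N_kernel:
  fixes S :: "('s, 'a, 'c) nsemigroup_scheme"
  assumes "zero_symmetric_near_semiring N" "N_semigroup N S" "\<phi> \<in> N_hom N (regular N) S"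
    and "modular_map N \<phi>"
  shows "modular_right_ideal N (N_kernel (regular N) S \<phi>)"
  by (rule N_hom_image_copy[OF assms(1-3)]) (use assms(4) in \<open>auto simp: modular_right_ideal_def\<close>)

end

theory Submission
  imports Defs
begin

text \<open>Both radicals vanish because \<open>{0}\<close> is the only right ideal other than \<open>\<N>\<close> itself, and it is
  modular.

  Let \<open>c\<close> be the constant map with value \<open>\<vartheta>\<close>. It lies in \<open>A\<^sup>+(B\<^sub>n)\<close>, and it satisfies \<open>f + c = c\<close> and
  \<open>fc = c\<close> for every map \<open>f\<close>, since \<open>\<vartheta>\<close> absorbs addition and a map followed by a constant map is
  that constant. Let \<open>\<phi>\<close> be an \<open>\<N>\<close>-morphism whose kernel contains some \<open>f \<noteq> 0\<close>. Kernels are closed under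
  right multiplication, so \<open>c = fc\<close> is in the kernel; then
  \<open>g\<phi> = g\<phi> + c\<phi> = (g + c)\<phi> = c\<phi>\<close> is trivial for every \<open>g \<noteq> 0\<close>. Hence the kernel is all of \<open>\<N>\<close>
  (lemma \<open>right_ideal_adjoin_zero\<close>).

  Conversely, sums and products of elements of \<open>A\<^sup>+(B\<^sub>n)\<close> are never the adjoined \<open>0\<close>. The map that only
  records whether an element is \<open>0\<close> is therefore an \<open>\<N>\<close>-morphism onto a two-element
  \<open>\<N>\<close>-semigroup. It has kernel \<open>{0}\<close>, and left multiplication by any \<open>u \<noteq> 0\<close> does not change its values,
  so it is modular (lemma \<open>modular_right_ideal_null\<close>).

  Thus \<open>{0}\<close> is at once the only maximal modular right ideal and the only modular maximal right
  ideal.\<close>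

lemma modular_right_ideal_imp_right_ideal:
  "modular_right_ideal N I \<Longrightarrow> right_ideal N I"
  unfolding modular_right_ideal_def right_ideal_def by blast

text \<open>The action fixes the identity of the target because \<open>0\<phi> = (00)\<phi> = (0\<phi>)0\<close> is that identity, and
  \<open>(0\<phi>)a = (0a)\<phi> = 0\<phi>\<close>. This is what makes kernels closed under right multiplication.\<close>

lemma N_hom_null:
  assumes "zero_symmetric_near_semiring N" and "N_semigroup N S"
    and "\<phi> \<in> N_hom N (regular N) S"
  shows "\<phi> \<zero>\<^bsub>N\<^esub> = ident S"
    and "a \<in> carrier N \<Longrightarrow> ident S \<odot>\<^bsub>S\<^esub> a = ident S"
proof -
  interpret N: zero_symmetric_near_semiring N by fact
  interpret S: N_semigroup N S by fact
  have clos: "\<phi> \<zero>\<^bsub>N\<^esub> \<in> carrier S"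
    using assms(3) N.null_closed by (auto simp: N_hom_def sgroup_hom_def regular_def)
  have act: "\<phi> (\<zero>\<^bsub>N\<^esub> \<otimes>\<^bsub>N\<^esub> a) = \<phi> \<zero>\<^bsub>N\<^esub> \<odot>\<^bsub>S\<^esub> a" if "a \<in> carrier N" for a
    using assms(3) N.null_closed that by (auto simp: N_hom_def regular_def)
  show 1: "\<phi> \<zero>\<^bsub>N\<^esub> = ident S"
    using act[OF N.null_closed] S.act_null[OF clos] N.null_times[OF N.null_closed] by simp
  show "ident S \<odot>\<^bsub>S\<^esub> a = ident S" if "a \<in> carrier N"
    using act[OF that] N.null_times[OF that] 1 by simp
qed

text \<open>One nonzero element \<open>f\<close> of the kernel puts \<open>z = fz\<close> into it, and \<open>z\<close> absorbs everything else.\<close>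

lemma right_ideal_adjoin_zero:
  assumes M: "near_semiring M" and z: "z \<in> carrier M"
    and plus_z: "\<And>x. x \<in> carrier M \<Longrightarrow> x \<oplus>\<^bsub>M\<^esub> z = z"
    and times_z: "\<And>x. x \<in> carrier M \<Longrightarrow> x \<otimes>\<^bsub>M\<^esub> z = z"
    and I: "right_ideal (adjoin_zero M) I"
  shows "I = {\<zero>\<^bsub>adjoin_zero M\<^esub>} \<or> I = carrier (adjoin_zero M)"
proof -
  let ?N = "adjoin_zero M"
  have N: "zero_symmetric_near_semiring ?N"
    using M by (rule zero_symmetric_adjoin_zero)
  obtain S :: "('a option, 'a option) nsemigroup" and \<phi>
    where S: "N_semigroup ?N S" and \<phi>: "\<phi> \<in> N_hom ?N (regular ?N) S"
      and ker: "I = N_kernel (regular ?N) S \<phi>"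
    using I unfolding right_ideal_def by blast
  interpret S: N_semigroup ?N S by (rule S)
  have carr: "carrier ?N = insert None (Some ` carrier M)" and null: "\<zero>\<^bsub>?N\<^esub> = None"
    by (simp_all add: adjoin_zero_def)
  have None_ker: "\<phi> None = ident S"
    using N_hom_null(1)[OF N S \<phi>] null by simp
  have clos: "\<phi> x \<in> carrier S" if "x \<in> carrier ?N" for x
    using \<phi> that by (auto simp: N_hom_def sgroup_hom_def regular_def)
  have plus: "\<phi> (Some (x \<oplus>\<^bsub>M\<^esub> y)) = \<phi> (Some x) \<oplus>\<^bsub>S\<^esub> \<phi> (Some y)"
    and times: "\<phi> (Some (x \<otimes>\<^bsub>M\<^esub> y)) = \<phi> (Some x) \<odot>\<^bsub>S\<^esub> Some y"
    if "x \<in> carrier M" "y \<in> carrier M" for x y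
    using \<phi> that by (auto simp: N_hom_def sgroup_hom_def regular_def adjoin_zero_def)
  show ?thesis
  proof (cases "I = {None}")
    case False
    then obtain f where f: "f \<in> carrier M" "\<phi> (Some f) = ident S"
      using ker None_ker by (auto simp: N_kernel_def regular_def carr)
    have "\<phi> (Some z) = ident S"
      using times[OF f(1) z] times_z[OF f(1)] f(2) N_hom_null(2)[OF N S \<phi>, of "Some z"] z
      by (simp add: carr)
    then have "\<phi> (Some x) = ident S" if "x \<in> carrier M" for x
      using plus[OF that z] plus_z[OF that] S.plus_ident[OF clos[of "Some x"]] that
      by (simp add: carr)
    then show ?thesis
      using None_ker by (auto simp: ker N_kernel_def regular_def carr)
  qed (simp add: null)
qed

text \<open>The two-element target is \<open>{False, True}\<close> under disjunction, with identity \<open>False\<close>; acting by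
  \<open>a\<close> sends \<open>True\<close> to the truth value of \<open>a \<noteq> 0\<close>. The axioms hold because an adjoined zero is
  neither a sum nor a product of nonzero elements.\<close>

lemma modular_right_ideal_null:
  assumes M: "near_semiring M" and u: "u \<in> carrier M"
  shows "modular_right_ideal (adjoin_zero M) {\<zero>\<^bsub>adjoin_zero M\<^esub>}"
proof -
  let ?N = "adjoin_zero M"
  define S :: "(bool, 'a option) nsemigroup" where
    "S = \<lparr>carrier = UNIV, plus = (\<or>), ident = False, act = (\<lambda>s a. s \<and> a \<noteq> None)\<rparr>"
  define \<phi> :: "'a option \<Rightarrow> bool" where "\<phi> a = (a \<noteq> None)" for a
  have S: "N_semigroup ?N S"
    by unfold_locales (auto simp: S_def adjoin_zero_def)
  have \<phi>: "\<phi> \<in> N_hom ?N (regular ?N) S"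
    by (auto simp: N_hom_def sgroup_hom_def regular_def adjoin_zero_def S_def \<phi>_def)
  have "modular_map ?N \<phi>"
    unfolding modular_map_def
    by (rule bexI[of _ "Some u"]) (auto simp: adjoin_zero_def \<phi>_def u)
  then have "modular_right_ideal ?N (N_kernel (regular ?N) S \<phi>)"
    by (rule modular_right_ideal_N_kernel[OF zero_symmetric_adjoin_zero[OF M] S \<phi>])
  moreover have "N_kernel (regular ?N) S \<phi> = {\<zero>\<^bsub>?N\<^esub>}"
    by (auto simp: N_kernel_def regular_def adjoin_zero_def S_def \<phi>_def)
  ultimately show ?thesis by simp
qed

lemma radicals_adjoin_zero:
  assumes M: "near_semiring M" and z: "z \<in> carrier M"
    and plus_z: "\<And>x. x \<in> carrier M \<Longrightarrow> x \<oplus>\<^bsub>M\<^esub> z = z"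
    and times_z: "\<And>x. x \<in> carrier M \<Longrightarrow> x \<otimes>\<^bsub>M\<^esub> z = z"
  shows "R0 (adjoin_zero M) = {\<zero>\<^bsub>adjoin_zero M\<^esub>}"
    and "R1 (adjoin_zero M) = {\<zero>\<^bsub>adjoin_zero M\<^esub>}"
proof -
  let ?N = "adjoin_zero M"
  have dichotomy: "I = {\<zero>\<^bsub>?N\<^esub>} \<or> I = carrier ?N" if "right_ideal ?N I" for I
    using right_ideal_adjoin_zero[OF M z plus_z times_z that] .
  have null: "modular_right_ideal ?N {\<zero>\<^bsub>?N\<^esub>}"
    using M z by (rule modular_right_ideal_null)
  have proper: "{\<zero>\<^bsub>?N\<^esub>} \<noteq> carrier ?N" and mem: "\<zero>\<^bsub>?N\<^esub> \<in> carrier ?N"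
    using z by (auto simp: adjoin_zero_def)
  have "{I. maximal_modular_right_ideal ?N I} = {{\<zero>\<^bsub>?N\<^esub>}}"
    unfolding maximal_modular_right_ideal_def
    using dichotomy null proper modular_right_ideal_imp_right_ideal by blast
  then show "R0 ?N = {\<zero>\<^bsub>?N\<^esub>}"
    using mem by (simp add: R0_def)
  have "{I. modular_maximal_right_ideal ?N I} = {{\<zero>\<^bsub>?N\<^esub>}}"
    unfolding modular_maximal_right_ideal_def maximal_right_ideal_def
    using dichotomy null proper modular_right_ideal_imp_right_ideal by blast
  then show "R1 ?N = {\<zero>\<^bsub>?N\<^esub>}"
    using mem by (simp add: R1_def)
qed

text \<open>The constant map is affine because \<open>\<vartheta>\<close> is idempotent: it is the sum of itself as an
  endomorphism and itself as a constant.\<close>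

lemma const_Theta_in_affine_nearsr:
  "(\<lambda>x \<in> carrier (Brandt n). \<vartheta>) \<in> carrier (affine_nearsr (Brandt n))"
proof -
  let ?c = "\<lambda>x \<in> carrier (Brandt n). \<vartheta>"
  have \<vartheta>: "\<vartheta> \<in> carrier (Brandt n)"
    by (simp add: Brandt_def)
  have endo: "?c \<in> carrier (map_nearsr (Brandt n)) \<inter> sgroup_hom (Brandt n) (Brandt n)"
    using semigrp.plus_closed[OF semigrp_Brandt[of n]] \<vartheta>
    by (auto simp: map_nearsr_def sgroup_hom_def) (simp add: Brandt_def)
  moreover have "?c = ?c \<oplus>\<^bsub>map_nearsr (Brandt n)\<^esub> ?c"
    by (auto simp: map_nearsr_def Brandt_def intro!: restrict_ext)
  ultimately have "?c \<in> affine_maps (Brandt n)"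
    unfolding affine_maps_def using \<vartheta> by blast
  then show ?thesis
    by (simp add: affine_nearsr_def generated.incl)
qed

lemma const_Theta_absorbs:
  assumes "f \<in> carrier (affine_nearsr (Brandt n))"
  shows "f \<oplus>\<^bsub>affine_nearsr (Brandt n)\<^esub> (\<lambda>x \<in> carrier (Brandt n). \<vartheta>)
      = (\<lambda>x \<in> carrier (Brandt n). \<vartheta>)" (is ?plus)
    and "f \<otimes>\<^bsub>affine_nearsr (Brandt n)\<^esub> (\<lambda>x \<in> carrier (Brandt n). \<vartheta>)
      = (\<lambda>x \<in> carrier (Brandt n). \<vartheta>)" (is ?times)
proof -
  have "f \<in> carrier (map_nearsr (Brandt n))"
    using assms generated_affine_subset[OF semigrp_Brandt[of n]]
    by (auto simp: affine_nearsr_def)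
  then have f: "f x \<in> carrier (Brandt n)" if "x \<in> carrier (Brandt n)" for x
    using that by (auto simp: map_nearsr_def)
  have "a \<oplus>\<^bsub>Brandt n\<^esub> \<vartheta> = \<vartheta>" for a
    by (cases a) (simp_all add: Brandt_def)
  then show ?plus
    by (auto simp: affine_nearsr_def map_nearsr_def intro!: restrict_ext)
  show ?times
    using f by (auto simp: affine_nearsr_def map_nearsr_def intro!: restrict_ext)
qed

theorem theorem4p4:
  fixes n :: nat
  assumes "n \<ge> 1"
  shows "R0 (brandt_nearsr n) = {\<zero>\<^bsub>brandt_nearsr n\<^esub>} \<and>
         R1 (brandt_nearsr n) = {\<zero>\<^bsub>brandt_nearsr n\<^esub>}"
  unfolding brandt_nearsr_def
  using radicals_adjoin_zero[OF near_semiring_affine_nearsr[OF semigrp_Brandt]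
      const_Theta_in_affine_nearsr const_Theta_absorbs]
  by simp

end
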